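(* Let $R$ be a commutative ring with unity that has at least one nontrivial idempotent and satisfies $|U(R)|\ge 2$. Then: (i) If $U''(R)=\emptyset$, then $\beta(\mathrm{Cl}_2(R)_{SR})=|\mathrm{Id}(R)^*|+1$. (ii) If $|U''(R)|=2$ and $\max\{2|\mathrm{Id}_\perp(R)^*|,|\mathrm{Id}(R)^*|\}=|\mathrm{Id}(R)^*|$, then $\beta(\mathrm{Cl}_2(R)_{SR})=|\mathrm{Id}(R)^*|+2$. (iii) If $|U''(R)|=2$ and $\max\{2|\mathrm{Id}_\perp(R)^*|,|\mathrm{Id}(R)^*|\}=2|\mathrm{Id}_\perp(R)^*|$, then $\beta(\mathrm{Cl}_2(R)_{SR})=2|\mathrm{Id}_\perp(R)^*|+1$. (iv) If $|U''(R)|>2$, then $\beta(\mathrm{Cl}_2(R)_{SR})=\max\{2|\mathrm{Id}_\perp(R)^*|,|\mathrm{Id}(R)^*|\}+2$.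
   Context: All rings are commutative with unity. $U(R)$ is the set of units, $\mathrm{Id}(R)$ the set of idempotents, $\mathrm{Id}(R)^*=\mathrm{Id}(R)\setminus\{0,1\}$; $\mathrm{Id}_\perp(R)$ denotes a set of pairwise orthogonal idempotents ($ef=0$ for distinct members $e,f$) of maximum cardinality and $\mathrm{Id}_\perp(R)^*=\mathrm{Id}_\perp(R)\setminus\{0\}$. $U'(R)=\{u\in U(R):u^2=1\}$, $U''(R)=U(R)\setminus U'(R)$. The clean graph $\mathrm{Cl}(R)$ has vertex set $\{(e,u): e\in\mathrm{Id}(R), u\in U(R)\}$, two distinct vertices $(e,u),(f,v)$ being adjacent iff $ef=0$ or $uv=1$; $\mathrm{Cl}_2(R)$ is its subgraph induced by the vertices with $e\neq 0$. In a connected graph $\Gamma$ with distance $d$ and neighbourhoods $N(x)$, $x$ is maximally distant from $y$ if $d(y,w)\le d(x,y)$ for all $w\in N(x)$, and $x,y$ are mutually maximally distant (MMD) if each is maximally distant from the other. The strong resolving graph $\Gamma_{SR}$ has as vertex set the vertices MMD with some vertex, two vertices adjacent iff MMD in $\Gamma$. $\beta$ denotes the independence number (maximum size of a set of pairwise nonadjacent vertices).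
   Formalization: In (iii) it is additionally assumed that the maximum is not |Id(R)*|, i.e. the tie 2|Id_⊥(R)*| = |Id(R)*| is left to (ii); in a finite tie, e.g. F4×F2×F2, (ii) gives 8 while (iii) as written would give 7, so (iii) is false there. *)

theory Defs
  imports Main "HOL-Library.Extended_Nat"
begin

unbundle cardinal_syntax

section \<open>Graphs\<close>

text \<open>A simple graph is a vertex set with a symmetric irreflexive set of ordered pairs of
  vertices (each edge is listed in both directions).\<close>

record 'v ugraph =
  verts :: "'v set"
  edges :: "('v \<times> 'v) set"

definition induced_subgraph :: "'v ugraph \<Rightarrow> 'v set \<Rightarrow> 'v ugraph" where
  "induced_subgraph G W =
     \<lparr>verts = verts G \<inter> W, edges = {(x, y) \<in> edges G. x \<in> W \<and> y \<in> W}\<rparr>"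

definition nbhd :: "'v ugraph \<Rightarrow> 'v \<Rightarrow> 'v set" where
  "nbhd G x = {y. (x, y) \<in> edges G}"

text \<open>Least length of a walk; \<open>\<infinity>\<close> if there is none.\<close>

definition gdist :: "'v ugraph \<Rightarrow> 'v \<Rightarrow> 'v \<Rightarrow> enat" where
  "gdist G x y = Inf {enat n | n. (x, y) \<in> edges G ^^ n}"

definition maximally_distant :: "'v ugraph \<Rightarrow> 'v \<Rightarrow> 'v \<Rightarrow> bool" where
  "maximally_distant G x y \<longleftrightarrow> (\<forall>w \<in> nbhd G x. gdist G y w \<le> gdist G x y)"

definition MMD :: "'v ugraph \<Rightarrow> 'v \<Rightarrow> 'v \<Rightarrow> bool" where
  "MMD G x y \<longleftrightarrow> maximally_distant G x y \<and> maximally_distant G y x"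

definition strong_resolving_graph :: "'v ugraph \<Rightarrow> 'v ugraph" where
  "strong_resolving_graph G =
     \<lparr>verts = {x \<in> verts G. \<exists>y \<in> verts G. MMD G x y},
      edges = {(x, y). x \<in> verts G \<and> y \<in> verts G \<and> x \<noteq> y \<and> MMD G x y}\<rparr>"

definition independent_set :: "'v ugraph \<Rightarrow> 'v set \<Rightarrow> bool" where
  "independent_set G S \<longleftrightarrow> S \<subseteq> verts G \<and> pairwise (\<lambda>x y. (x, y) \<notin> edges G) S"

text \<open>Rings, hence the graphs, may be infinite, so sizes are cardinals: \<open>\<beta>(G) = \<kappa>\<close> says that
  \<open>\<kappa>\<close> is the maximum of the cardinalities of the independent sets, and that it is attained.\<close>

definition has_independence_number :: "'v ugraph \<Rightarrow> 'c rel \<Rightarrow> bool" where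
  "has_independence_number G \<kappa> \<longleftrightarrow>
     (\<exists>S. independent_set G S \<and> |S| =o \<kappa>) \<and> (\<forall>S. independent_set G S \<longrightarrow> |S| \<le>o \<kappa>)"

text \<open>Maximum of two cardinals; the vacuous summand \<open>czero\<close> only serves to give the two
  branches a common type.\<close>

definition cmax :: "'a rel \<Rightarrow> 'b rel \<Rightarrow> ('a + 'b) rel" where
  "cmax r s = (if r \<le>o s then (czero :: 'a rel) +c s else r +c (czero :: 'b rel))"


section \<open>Clean graphs\<close>

text \<open>The ring is the type \<open>'a\<close>; the \<open>itself\<close> argument only names it.\<close>

definition units :: "'a::comm_ring_1 itself \<Rightarrow> 'a set" where
  "units _ = {u. u dvd 1}"

definition idems :: "'a::comm_ring_1 itself \<Rightarrow> 'a set" where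
  "idems _ = {e. e * e = e}"

definition nontriv_idems :: "'a::comm_ring_1 itself \<Rightarrow> 'a set" where
  "nontriv_idems R = idems R - {0, 1}"

definition units' :: "'a::comm_ring_1 itself \<Rightarrow> 'a set" where
  "units' R = {u \<in> units R. u\<^sup>2 = 1}"

definition units'' :: "'a::comm_ring_1 itself \<Rightarrow> 'a set" where
  "units'' R = units R - units' R"

definition orthogonal_idems :: "'a::comm_ring_1 itself \<Rightarrow> 'a set \<Rightarrow> bool" where
  "orthogonal_idems R D \<longleftrightarrow> D \<subseteq> idems R \<and> pairwise (\<lambda>e f. e * f = 0) D"

text \<open>\<open>max_orthogonal_idems R D\<close>: the set \<open>D\<close> is an admissible choice of \<open>Id\<^sub>\<bottom>(R)\<close>.\<close>

definition max_orthogonal_idems :: "'a::comm_ring_1 itself \<Rightarrow> 'a set \<Rightarrow> bool" where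
  "max_orthogonal_idems R D \<longleftrightarrow>
     orthogonal_idems R D \<and> (\<forall>D'. orthogonal_idems R D' \<longrightarrow> |D'| \<le>o |D| )"

definition clean_graph :: "'a::comm_ring_1 itself \<Rightarrow> ('a \<times> 'a) ugraph" where
  "clean_graph R =
     \<lparr>verts = idems R \<times> units R,
      edges = {((e, u), (f, v)). e \<in> idems R \<and> u \<in> units R \<and> f \<in> idems R \<and> v \<in> units R \<and>
                 (e, u) \<noteq> (f, v) \<and> (e * f = 0 \<or> u * v = 1)}\<rparr>"

definition clean_graph2 :: "'a::comm_ring_1 itself \<Rightarrow> ('a \<times> 'a) ugraph" where
  "clean_graph2 R = induced_subgraph (clean_graph R) {(e, u). e \<noteq> 0}"

end

theory Submission
  imports Defs
begin

text \<open>
  Apart from the pairs \<open>(1, u)\<close>, \<open>(1, v)\<close>, which can be at distance 3, any two vertices of \<open>Cl\<^sub>2(R)\<close> are at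
  distance at most 2. Adjacent vertices are never mutually maximally distant, because they would have
  the same closed neighbourhood. Hence distinct \<open>(e, u)\<close>, \<open>(f, v)\<close> are mutually maximally distant iff
  \<open>e f \<noteq> 0\<close>, \<open>u v \<noteq> 1\<close>, and either \<open>e = 1 \<longleftrightarrow> f = 1\<close> or \<open>u = v\<close>.

  In an independent set every fibre over an idempotent consists of pairwise inverse units, so it has at
  most two elements, and a two-element fibre lies in \<open>U''\<close>. Let \<open>P\<close> and \<open>Q\<close> be the sets of nontrivial
  idempotents with fibres of size two and one. Members of \<open>P\<close> are orthogonal to all other members of
  \<open>P \<union> Q\<close>, and taking complements of idempotents yields
  \<open>2 |P| + |Q| \<le> max {2 |Id\<^sub>\<bottom>\<^sup>*|, |Id\<^sup>*|}\<close>. The fibre over 1 contributes at most two further vertices, and it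
  shares no unit of \<open>U''\<close> with the other fibres, which costs one vertex
  when \<open>|U''| = 2\<close> and the maximum comes from two-element fibres.
  If \<open>Id\<^sup>*\<close> is infinite, all cardinals in question equal \<open>|Id\<^sup>*|\<close>.
\<close>

section \<open>Distances\<close>

text \<open>A nonempty set of extended naturals attains its infimum, while the infimum of the empty
  set is infinite and meets no finite bound.\<close>

lemma gdist_le_iff: "gdist G x y \<le> enat n \<longleftrightarrow> (\<exists>m\<le>n. (x, y) \<in> edges G ^^ m)"
proof
  assume le: "gdist G x y \<le> enat n"
  let ?A = "{enat m | m. (x, y) \<in> edges G ^^ m}"
  have ne: "?A \<noteq> {}"
  proof
    assume "?A = {}"
    then have "gdist G x y = \<infinity>"
      by (simp only: gdist_def Inf_enat_def simp_thms if_True)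
    with le show False by simp
  qed
  then have "Inf ?A \<in> ?A"
    unfolding Inf_enat_def by (auto intro: LeastI)
  with le show "\<exists>m\<le>n. (x, y) \<in> edges G ^^ m"
    unfolding gdist_def by auto
next
  assume "\<exists>m\<le>n. (x, y) \<in> edges G ^^ m"
  then obtain m where "m \<le> n" "(x, y) \<in> edges G ^^ m" by blast
  then have "gdist G x y \<le> enat m"
    unfolding gdist_def by (intro Inf_lower) blast
  with \<open>m \<le> n\<close> show "gdist G x y \<le> enat n"
    by (meson enat_ord_simps(1) order_trans)
qed

lemma gdist_le_1_iff: "gdist G x y \<le> enat 1 \<longleftrightarrow> x = y \<or> (x, y) \<in> edges G"
proof -
  have "m \<le> 1 \<longleftrightarrow> m \<in> {0, 1}" for m :: nat by auto
  then have "gdist G x y \<le> enat 1 \<longleftrightarrow> (\<exists>m\<in>{0, 1}. (x, y) \<in> edges G ^^ m)"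
    unfolding gdist_le_iff by blast
  then show ?thesis by auto
qed

lemma gdist_le_2_iff:
  "gdist G x y \<le> enat 2 \<longleftrightarrow>
     x = y \<or> (x, y) \<in> edges G \<or> (\<exists>z. (x, z) \<in> edges G \<and> (z, y) \<in> edges G)"
proof -
  have "gdist G x y \<le> enat 2 \<longleftrightarrow> (\<exists>m\<in>{0, 1, 2}. (x, y) \<in> edges G ^^ m)"
  proof -
    have "m \<le> 2 \<longleftrightarrow> m \<in> {0, 1, 2}" for m :: nat by auto
    then show ?thesis unfolding gdist_le_iff by blast
  qed
  then show ?thesis
    by (auto simp: relcomp_unfold numeral_2_eq_2)
qed

lemma gdist_commute:
  assumes "sym (edges G)"
  shows "gdist G x y = gdist G y x"
proof -
  have "(x, y) \<in> edges G ^^ n \<Longrightarrow> (y, x) \<in> edges G ^^ n" for x y n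
    by (induction n arbitrary: x y)
      (auto simp del: relpow.simps(2) elim!: relpow_Suc_E intro: relpow_Suc_I2 symD[OF assms])
  then have "(x, y) \<in> edges G ^^ n \<longleftrightarrow> (y, x) \<in> edges G ^^ n" for n
    by blast
  then show ?thesis
    unfolding gdist_def by simp
qed

lemma MMD_commute: "MMD G x y \<longleftrightarrow> MMD G y x"
  unfolding MMD_def by blast

section \<open>The strong resolving graph of the clean graph\<close>

lemma one_mem_units: "1 \<in> units R"
  by (simp add: units_def)

lemma one_mem_idems: "1 \<in> idems R"
  by (simp add: idems_def)

lemma one_minus_mem_idems: "e \<in> idems R \<Longrightarrow> 1 - e \<in> idems R"
  by (simp add: idems_def algebra_simps)

lemma idem_times_compl: "e \<in> idems R \<Longrightarrow> e * (1 - e) = 0" "e \<in> idems R \<Longrightarrow> (1 - e) * e = 0"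
  by (simp_all add: idems_def algebra_simps)

text \<open>Makes \<open>(e, u)\<close> and \<open>(1 - e, w)\<close> distinct, hence adjacent
  whenever both are vertices.\<close>

lemma compl_neq_idem:
  assumes "e \<in> idems R" "e \<noteq> 0"
  shows "1 - e \<noteq> e"
proof
  assume "1 - e = e"
  with idem_times_compl(1)[OF assms(1)] have "e * e = 0" by simp
  with assms show False by (simp add: idems_def)
qed

lemma obtain_unit_inverse:
  assumes "u \<in> units R"
  obtains v where "v \<in> units R" "u * v = 1" "v * u = 1"
proof -
  obtain v where "u * v = 1" using assms by (auto simp: units_def dvd_def)
  moreover from this have "v dvd 1" by (metis dvd_triv_right)
  ultimately show thesis using that[of v] by (simp add: units_def mult.commute)
qed

lemma unit_inverse_unique:
  fixes u :: "'a::comm_ring_1"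
  assumes "u * v = 1" "u * w = 1"
  shows "v = w"
proof -
  have "v = (u * w) * v" using assms(2) by simp
  also have "\<dots> = (u * v) * w" by (simp only: ac_simps)
  finally show ?thesis using assms(1) by simp
qed

section \<open>Edges and distances in the clean graph\<close>

lemma verts_clean_graph2: "verts (clean_graph2 R) = (idems R - {0}) \<times> units R"
  by (auto simp: clean_graph2_def clean_graph_def induced_subgraph_def)

lemma edges_clean_graph2_iff:
  "((e, u), (f, v)) \<in> edges (clean_graph2 R) \<longleftrightarrow>
     (e, u) \<in> verts (clean_graph2 R) \<and> (f, v) \<in> verts (clean_graph2 R) \<and> (e, u) \<noteq> (f, v) \<and>
     (e * f = 0 \<or> u * v = 1)"
  by (auto simp: clean_graph2_def clean_graph_def induced_subgraph_def)

lemma sym_edges_clean_graph2: "sym (edges (clean_graph2 R))"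
  by (auto simp: sym_def edges_clean_graph2_iff mult.commute)

lemma nbhd_subset_verts: "nbhd (clean_graph2 R) x \<subseteq> verts (clean_graph2 R)"
  by (cases x) (auto simp: nbhd_def edges_clean_graph2_iff)

text \<open>The midpoint is \<open>(1 - e, w)\<close> with \<open>w\<close> inverse to
  \<open>v\<close>: orthogonality gives the first edge, the units give the second. For
  \<open>e = 1\<close> the midpoint would not be a vertex.\<close>

lemma gdist_le_2:
  assumes "(e, u) \<in> verts (clean_graph2 R)" "(f, v) \<in> verts (clean_graph2 R)" "e \<noteq> 1"
  shows "gdist (clean_graph2 R) (e, u) (f, v) \<le> enat 2"
proof -
  let ?E = "edges (clean_graph2 R)"
  have e: "e \<in> idems R" "e \<noteq> 0" and f: "f \<in> idems R" "f \<noteq> 0" and u: "u \<in> units R"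
    and v: "v \<in> units R" using assms by (auto simp: verts_clean_graph2)
  obtain w where w: "w \<in> units R" "v * w = 1" "w * v = 1" using v by (rule obtain_unit_inverse)
  have c: "1 - e \<in> idems R" "1 - e \<noteq> 0" using e assms(3) by (auto simp: one_minus_mem_idems)
  have "1 - e \<noteq> e" using e by (rule compl_neq_idem)
  then have 1: "((e, u), (1 - e, w)) \<in> ?E"
    using e c u w by (auto simp: edges_clean_graph2_iff verts_clean_graph2 idem_times_compl)
  have "(f, v) = (1 - e, w) \<or> ((1 - e, w), (f, v)) \<in> ?E"
    using f c v w by (auto simp: edges_clean_graph2_iff verts_clean_graph2)
  with 1 show ?thesis unfolding gdist_le_2_iff by auto
qed

lemma gdist_le_2':
  assumes "(e, u) \<in> verts (clean_graph2 R)" "(f, v) \<in> verts (clean_graph2 R)" "f \<noteq> 1"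
  shows "gdist (clean_graph2 R) (e, u) (f, v) \<le> enat 2"
  using gdist_le_2[OF assms(2,1,3)] by (simp add: gdist_commute[OF sym_edges_clean_graph2])

text \<open>Only 0 is orthogonal to 1, so every edge at a vertex over 1 comes from inverse units. A
  common neighbour would carry the inverse of both \<open>u\<close> and \<open>v\<close>.\<close>

lemma gdist_one_one_le_2_iff:
  assumes "u \<in> units R" "v \<in> units R" "(1::'a::comm_ring_1) \<noteq> 0"
  shows "gdist (clean_graph2 R) (1::'a, u) (1, v) \<le> enat 2 \<longleftrightarrow> u = v \<or> u * v = 1"
proof -
  have "u = v" if "((1, u), (g, w)) \<in> edges (clean_graph2 R)" "((g, w), (1, v)) \<in> edges (clean_graph2 R)"
    for g w
  proof -
    have "w * u = 1" "w * v = 1"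
      using that by (auto simp: edges_clean_graph2_iff verts_clean_graph2 mult.commute)
    then show "u = v" by (rule unit_inverse_unique)
  qed
  moreover have "((1, u), (1, v)) \<in> edges (clean_graph2 R)" if "u \<noteq> v" "u * v = 1"
    using that assms by (auto simp: edges_clean_graph2_iff verts_clean_graph2 one_mem_idems)
  ultimately show ?thesis
    unfolding gdist_le_2_iff by (auto simp: edges_clean_graph2_iff)
qed

text \<open>At most one step, through inverse units, leads from \<open>x\<close> to a vertex over a
  nontrivial idempotent \<open>g\<close>; from there everything is within distance 2.\<close>

lemma gdist_le_3:
  assumes "nontriv_idems R \<noteq> {}"
    and "x \<in> verts (clean_graph2 R)" "y \<in> verts (clean_graph2 R)"
  shows "gdist (clean_graph2 R) x y \<le> enat 3"
proof -
  let ?G = "clean_graph2 R"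
  obtain e u where x: "x = (e, u)" by force
  have xv: "e \<in> idems R" "e \<noteq> 0" "u \<in> units R" using assms(2) x by (auto simp: verts_clean_graph2)
  obtain g where g: "g \<in> idems R" "g \<noteq> 0" "g \<noteq> 1"
    using assms(1) by (auto simp: nontriv_idems_def)
  obtain w where w: "w \<in> units R" "u * w = 1" using xv(3) by (rule obtain_unit_inverse)
  have gv: "(g, w) \<in> verts ?G" using g w by (auto simp: verts_clean_graph2)
  have "gdist ?G (g, w) y \<le> enat 2" using gdist_le_2 gv g assms(3) by (cases y) blast
  then obtain m where m: "m \<le> 2" "((g, w), y) \<in> edges ?G ^^ m" unfolding gdist_le_iff by blast
  have "x = (g, w) \<or> (x, (g, w)) \<in> edges ?G"
    using assms(2) gv w unfolding x edges_clean_graph2_iff by blast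
  then show ?thesis
  proof
    assume "x = (g, w)"
    then show ?thesis using m by (auto simp: gdist_le_iff intro!: exI[of _ m])
  next
    assume "(x, (g, w)) \<in> edges ?G"
    then have "(x, y) \<in> edges ?G ^^ Suc m" using m(2) by (rule relpow_Suc_I2)
    then show ?thesis using m(1) unfolding gdist_le_iff by (intro exI[of _ "Suc m"]) auto
  qed
qed

section \<open>Mutually maximally distant pairs\<close>

lemma MMD_I:
  assumes "sym (edges G)" "\<not> gdist G x y \<le> enat n"
    and "\<And>w. w \<in> nbhd G x \<Longrightarrow> gdist G y w \<le> enat (n + 1)"
    and "\<And>w. w \<in> nbhd G y \<Longrightarrow> gdist G x w \<le> enat (n + 1)"
  shows "MMD G x y"
proof -
  \<comment> \<open>Distances are naturals or infinite, so exceeding \<open>n\<close> means being at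
    least \<open>n + 1\<close>.\<close>
  have "enat (n + 1) \<le> gdist G x y" using assms(2) by (simp add: Suc_ile_eq not_le)
  then show ?thesis
    unfolding MMD_def maximally_distant_def gdist_commute[OF assms(1), of y x]
    using assms(3,4) order_trans by blast
qed

text \<open>Equal closed neighbourhoods first force \<open>e = f\<close> by comparing annihilators.
  The edge then joins distinct inverse units, and a third idempotent yields a neighbour of one
  endpoint that the other misses.\<close>

lemma not_MMD_if_edge:
  assumes "nontriv_idems R \<noteq> {}" "\<exists>w. w \<in> units R \<and> w \<noteq> 1"
    and edge: "((e, u), (f, v)) \<in> edges (clean_graph2 R)"
  shows "\<not> MMD (clean_graph2 R) (e, u) (f, v)"
proof
  let ?G = "clean_graph2 R"
  assume mmd: "MMD ?G (e, u) (f, v)"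
  have e: "e \<in> idems R" "e \<noteq> 0" and f: "f \<in> idems R" "f \<noteq> 0" and u: "u \<in> units R" and v: "v \<in> units R"
    using edge by (auto simp: edges_clean_graph2_iff verts_clean_graph2)
  have edge': "((f, v), (e, u)) \<in> edges ?G" using edge sym_edges_clean_graph2 by (meson symD)
  \<comment> \<open>The endpoints are at distance at most 1, so maximality keeps every neighbour of
    one in the closed neighbourhood of the other.\<close>
  have step: "w = (f, v) \<or> ((f, v), w) \<in> edges ?G"
    if "MMD ?G (e, u) (f, v)" "((e, u), (f, v)) \<in> edges ?G" "((e, u), w) \<in> edges ?G" for e u f v w
  proof -
    have "gdist ?G (e, u) (f, v) \<le> enat 1" using that(2) unfolding gdist_le_1_iff by simp
    moreover have "gdist ?G (f, v) w \<le> gdist ?G (e, u) (f, v)"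
      using that unfolding MMD_def maximally_distant_def nbhd_def by blast
    ultimately have "gdist ?G (f, v) w \<le> enat 1" by (rule order_trans[rotated])
    then show ?thesis unfolding gdist_le_1_iff by auto
  qed
  \<comment> \<open>Equal closed neighbourhoods force equal annihilators among the idempotents, since the second
    coordinate of a neighbour \<open>(1 - e, w)\<close> is arbitrary.\<close>
  have ann: "f * (1 - e) = 0"
    if mmd: "MMD ?G (e, u) (f, v)" and edge: "((e, u), (f, v)) \<in> edges ?G" for e u f v
  proof (rule ccontr)
    assume ne: "f * (1 - e) \<noteq> 0"
    have e: "e \<in> idems R" "e \<noteq> 0" and u: "u \<in> units R"  and v: "v \<in> units R"
      using edge by (auto simp: edges_clean_graph2_iff verts_clean_graph2)
    have *: "v * w = 1 \<or> w = v" if "w \<in> units R" for w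
    proof -
      have "((e, u), (1 - e, w)) \<in> edges ?G"
        using e u that ne compl_neq_idem[OF e]
        by (auto simp: edges_clean_graph2_iff verts_clean_graph2 one_minus_mem_idems idem_times_compl)
      from step[OF mmd edge this] show ?thesis
        using ne by (auto simp: edges_clean_graph2_iff)
    qed
    obtain t where t: "t \<in> units R" "t \<noteq> 1" using assms(2) by blast
    \<comment> \<open>Taking 1 for \<open>w\<close> in \<open>*\<close> gives \<open>v = 1\<close>;
      taking \<open>t\<close> then gives \<open>t = 1\<close>.\<close>
    have "v = 1" using *[OF one_mem_units] by auto
    with *[OF t(1)] t(2) show False by auto
  qed
  have "f = f * e" using ann[OF mmd edge] by (simp add: algebra_simps)
  moreover have "e = f * e" using ann[OF mmd[unfolded MMD_commute[of ?G "(e,u)"]] edge']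
    by (simp add: algebra_simps)
  ultimately have ef: "e = f" by simp
  then have "e * f \<noteq> 0" using e by (auto simp: idems_def)
  then have uv: "u * v = 1" "u \<noteq> v" using edge ef by (auto simp: edges_clean_graph2_iff)
  \<comment> \<open>With \<open>e * h\<close> nonzero, \<open>(h, v)\<close> is joined to
    \<open>(e, u)\<close> through the units only, so membership in the other neighbourhood would
    need \<open>v * v = 1\<close>.\<close>
  obtain h where h: "h \<in> idems R" "h \<noteq> 0" "h \<noteq> e" "e * h \<noteq> 0"
  proof (cases "e = 1")
    case True
    then show ?thesis using assms(1) that by (auto simp: nontriv_idems_def)
  next
    case False
    then show ?thesis using that[of 1] one_mem_idems[of R] e by auto
  qed
  have "((e, u), (h, v)) \<in> edges ?G"
    using e h u v uv by (auto simp: edges_clean_graph2_iff verts_clean_graph2)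
  from step[OF mmd edge this] have "v * v = 1"
    using h ef by (auto simp: edges_clean_graph2_iff)
  with uv show False using unit_inverse_unique[of v u v] by (simp add: mult.commute)
qed

text \<open>Distinct nonadjacent vertices have distance 3 if both lie over 1, and 2 otherwise.
  Distance 2 fails to be maximal only if some neighbour is at distance 3, which takes two vertices
  over 1; this can happen only when exactly one of \<open>e\<close>, \<open>f\<close> is 1.\<close>

lemma MMD_clean_graph2_iff:
  assumes "nontriv_idems R \<noteq> {}" "\<exists>w. w \<in> units R \<and> w \<noteq> 1"
    and x: "(e, u) \<in> verts (clean_graph2 R)" and y: "(f, v) \<in> verts (clean_graph2 R)"
    and ne: "(e, u) \<noteq> (f, v)"
  shows "MMD (clean_graph2 R) (e, u) (f, v) \<longleftrightarrow>
    e * f \<noteq> 0 \<and> u * v \<noteq> 1 \<and> ((e = 1 \<longleftrightarrow> f = 1) \<or> u = v)"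
proof -
  let ?G = "clean_graph2 R"
  note comm = gdist_commute[OF sym_edges_clean_graph2]
  have one: "(1::'a) \<noteq> 0" using x by (auto simp: verts_clean_graph2)
  have u: "u \<in> units R" and v: "v \<in> units R" using x y by (auto simp: verts_clean_graph2)
  have mixed_not: "\<not> MMD ?G (e, u) (1, v)"
    if "e \<noteq> 1" "(e, u) \<in> verts ?G" "(1, v) \<in> verts ?G" "u \<noteq> v" "u * v \<noteq> 1" for e u v
  proof
    assume mmd: "MMD ?G (e, u) (1, v)"
    have u: "u \<in> units R" and v: "v \<in> units R" using that by (auto simp: verts_clean_graph2)
    obtain w where w: "w \<in> units R" "u * w = 1" "w * u = 1" using u by (rule obtain_unit_inverse)
    \<comment> \<open>Over 1, the vertex \<open>(1, w)\<close> is farther than 2 from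
      \<open>(1, v)\<close> unless \<open>v\<close> is \<open>w\<close> or the inverse of
      \<open>w\<close>, which is \<open>u\<close>.\<close>
    have "((e, u), (1, w)) \<in> edges ?G"
      using that w by (auto simp: edges_clean_graph2_iff verts_clean_graph2)
    then have "gdist ?G (1, v) (1, w) \<le> gdist ?G (e, u) (1, v)"
      using mmd unfolding MMD_def maximally_distant_def nbhd_def by blast
    also have "\<dots> \<le> enat 2" using that gdist_le_2 by blast
    finally have "v = w \<or> v * w = 1" using gdist_one_one_le_2_iff[OF v w(1) one] by blast
    then show False using that w unit_inverse_unique[of w v u] by (auto simp: mult.commute)
  qed
  have nbhd_le_2: "gdist ?G (e, u) w \<le> enat (1 + 1)"
    if "w \<in> nbhd ?G z" "(e, u) \<in> verts ?G" "e \<noteq> 1" for w z e u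
  proof -
    have "(fst w, snd w) \<in> verts ?G" using that(1) nbhd_subset_verts[of R z] by auto
    with that(2) have "gdist ?G (e, u) (fst w, snd w) \<le> enat 2" using that(3) by (rule gdist_le_2)
    then show ?thesis by (simp only: prod.collapse one_add_one)
  qed
  have mixed: "MMD ?G (e, u) (1, u)"
    if e: "e \<noteq> 1" and eu: "(e, u) \<in> verts ?G" and 1: "(1, u) \<in> verts ?G" and uu: "u * u \<noteq> 1" for e u
  proof (rule MMD_I[OF sym_edges_clean_graph2])
    show "\<not> gdist ?G (e, u) (1, u) \<le> enat 1"
      using that unfolding gdist_le_1_iff by (auto simp: edges_clean_graph2_iff verts_clean_graph2)
    show "gdist ?G (e, u) w \<le> enat (1 + 1)" if "w \<in> nbhd ?G (1, u)" for w
      using that eu e by (rule nbhd_le_2)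
    show "gdist ?G (1, u) w \<le> enat (1 + 1)" if w: "w \<in> nbhd ?G (e, u)" for w
    proof -
      obtain g t where gt: "w = (g, t)" by force
      have wv: "(g, t) \<in> verts ?G" using w gt nbhd_subset_verts by blast
      have "gdist ?G (1, u) (g, t) \<le> enat 2"
      proof (cases "g = 1")
        case True
        \<comment> \<open>A neighbour of \<open>(e, u)\<close> over 1 is joined to it through the
          units, because \<open>e\<close> is nonzero.\<close>
        have "u * t = 1" using w eu unfolding gt True nbhd_def
          by (auto simp: edges_clean_graph2_iff verts_clean_graph2)
        then show ?thesis
          using gdist_one_one_le_2_iff[of u R t] one wv eu True by (auto simp: verts_clean_graph2)
      next
        case False
        with 1 wv show ?thesis by (rule gdist_le_2')
      qed
      then show ?thesis by (simp only: gt one_add_one)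
    qed
  qed
  show ?thesis
  proof (cases "e * f = 0 \<or> u * v = 1")
    case True
    then have "((e, u), (f, v)) \<in> edges ?G" using x y ne by (auto simp: edges_clean_graph2_iff)
    then show ?thesis using not_MMD_if_edge[OF assms(1,2)] True by blast
  next
    case nadj: False
    then have nle1: "\<not> gdist ?G (e, u) (f, v) \<le> enat 1"
      using ne unfolding gdist_le_1_iff by (simp add: edges_clean_graph2_iff)
    consider "e = 1" "f = 1" | "e \<noteq> 1" "f = 1" | "e = 1" "f \<noteq> 1" | "e \<noteq> 1" "f \<noteq> 1" by blast
    then show ?thesis
    proof cases
      case 1
      have "\<not> gdist ?G (e, u) (f, v) \<le> enat 2"
        using 1 ne nadj gdist_one_one_le_2_iff[OF u v one] by auto
      moreover have "gdist ?G z w \<le> enat (2 + 1)" if "w \<in> nbhd ?G z'" "z \<in> verts ?G" for z z' w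
        using gdist_le_3[OF assms(1) that(2), of w] that(1) nbhd_subset_verts[of R z'] by auto
      ultimately have "MMD ?G (e, u) (f, v)"
        using x y by (intro MMD_I[OF sym_edges_clean_graph2])
      then show ?thesis using 1 nadj by simp
    next
      case 2
      then show ?thesis using mixed_not[of e u v] mixed[of e u] x y nadj by (cases "u = v") auto
    next
      case 3
      have "MMD ?G (f, v) (e, u) \<longleftrightarrow> u = v"
        using 3 mixed_not[of f v u] mixed[of f u] x y nadj mult.commute[of u v] by (cases "u = v") auto
      then show ?thesis using 3 nadj MMD_commute by metis
    next
      case 4
      have "MMD ?G (e, u) (f, v)"
        using nbhd_le_2 x y 4 by (intro MMD_I[OF sym_edges_clean_graph2 nle1])
      then show ?thesis using 4 nadj by simp
    qed
  qed
qed

text \<open>Negates the criterion for mutual maximal distance, once it is known that no vertex is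
  lost in passing to the strong resolving graph.\<close>

lemma independent_set_clean_iff:
  assumes "nontriv_idems R \<noteq> {}" "\<exists>w. w \<in> units R \<and> w \<noteq> 1"
  shows "independent_set (strong_resolving_graph (clean_graph2 R)) S \<longleftrightarrow>
     S \<subseteq> (idems R - {0}) \<times> units R \<and>
     (\<forall>e u f v. (e, u) \<in> S \<and> (f, v) \<in> S \<and> (e, u) \<noteq> (f, v) \<longrightarrow>
        e * f = 0 \<or> u * v = 1 \<or> (e = 1) \<noteq> (f = 1) \<and> u \<noteq> v)"
proof -
  let ?G = "clean_graph2 R"
  note mmd = MMD_clean_graph2_iff[OF assms]
  \<comment> \<open>The partner keeps \<open>e\<close> and changes the unit if \<open>u\<close> is
    self-inverse; otherwise it keeps \<open>u\<close> and takes another idempotent not orthogonal to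
    \<open>e\<close>.\<close>
  have "\<exists>y\<in>verts ?G. MMD ?G (e, u) y" if x: "(e, u) \<in> verts ?G" for e u
  proof -
    have e: "e \<in> idems R" "e \<noteq> 0" and u: "u \<in> units R" using x by (auto simp: verts_clean_graph2)
    have ee: "e * e \<noteq> 0" using e by (auto simp: idems_def)
    show ?thesis
    proof (cases "u * u = 1")
      case True
      obtain w where w: "w \<in> units R" "w \<noteq> u" using assms(2) one_mem_units[of R] by metis
      then have "u * w \<noteq> 1" using True unit_inverse_unique by metis
      then have "MMD ?G (e, u) (e, w)"
        using x e w ee by (subst mmd) (auto simp: verts_clean_graph2)
      then show ?thesis using e w by (auto simp: verts_clean_graph2)
    next
      case False
      obtain g where g: "g \<in> idems R" "g \<noteq> 0" "g \<noteq> e" "e * g \<noteq> 0"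
      proof (cases "e = 1")
        case True
        then show ?thesis using assms(1) that by (auto simp: nontriv_idems_def)
      next
        case False
        then show ?thesis using that[of 1] one_mem_idems[of R] e by auto
      qed
      then have "MMD ?G (e, u) (g, u)"
        using x u False by (subst mmd) (auto simp: verts_clean_graph2)
      then show ?thesis using g u by (auto simp: verts_clean_graph2)
    qed
  qed
  then have V: "verts (strong_resolving_graph ?G) = verts ?G"
    by (auto simp: strong_resolving_graph_def)
  let ?adj = "\<lambda>e u f v. e * f = 0 \<or> u * v = 1 \<or> (e = 1) \<noteq> (f = 1) \<and> u \<noteq> v"
  have *: "((e, u), (f, v)) \<notin> edges (strong_resolving_graph ?G) \<longleftrightarrow> ?adj e u f v"
    if "(e, u) \<in> verts ?G" "(f, v) \<in> verts ?G" "(e, u) \<noteq> (f, v)" for e u f v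
    using mmd[OF that] that by (auto simp: strong_resolving_graph_def)
  have "pairwise (\<lambda>x y. (x, y) \<notin> edges (strong_resolving_graph ?G)) S \<longleftrightarrow>
     (\<forall>e u f v. (e, u) \<in> S \<and> (f, v) \<in> S \<and> (e, u) \<noteq> (f, v) \<longrightarrow> ?adj e u f v)" (is "?L \<longleftrightarrow> ?R")
    if sub: "S \<subseteq> verts ?G"
  proof
    assume L: ?L
    show ?R
    proof (intro allI impI, elim conjE)
      fix e u f v assume a: "(e, u) \<in> S" "(f, v) \<in> S" "(e, u) \<noteq> (f, v)"
      show "?adj e u f v"
        by (rule iffD1[OF * pairwiseD[OF L a]]) (use a sub in blast)+
    qed
  next
    assume R: ?R
    show ?L
    proof (rule pairwiseI)
      fix x y assume a: "x \<in> S" "y \<in> S" "x \<noteq> y"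
      obtain e u f v where xy: "x = (e, u)" "y = (f, v)" by (cases x, cases y)
      show "(x, y) \<notin> edges (strong_resolving_graph ?G)"
        unfolding xy by (rule iffD2[OF *]) (use a sub R xy in blast)+
    qed
  qed
  then show ?thesis
    unfolding independent_set_def V unfolding verts_clean_graph2 by (rule conj_cong[OF refl])
qed

section \<open>Counting\<close>

lemma units''_iff: "u \<in> units'' R \<longleftrightarrow> u \<in> units R \<and> u * u \<noteq> 1"
  by (auto simp: units''_def units'_def power2_eq_square)

text \<open>If \<open>u * u = 1\<close>, uniqueness of inverses would give \<open>u = v\<close>.
  This places two-element fibres inside \<open>units''\<close>.\<close>

lemma mem_units''_if_inverse:
  assumes "u * v = 1" "u \<noteq> v"
  shows "u \<in> units'' R"
proof -
  have "u dvd 1" using assms(1) by (metis dvd_triv_left)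
  moreover have "u * u \<noteq> 1" using assms unit_inverse_unique[of u u v] by blast
  ultimately show ?thesis by (simp add: units''_iff units_def)
qed

lemma obtain_units''_inverse:
  assumes "u \<in> units'' R"
  obtains v where "v \<in> units'' R" "u * v = 1" "u \<noteq> v"
proof -
  obtain v where v: "v \<in> units R" "u * v = 1" using assms obtain_unit_inverse by (metis units''_iff)
  then have "u \<noteq> v" using assms by (auto simp: units''_iff)
  then show thesis using that v mem_units''_if_inverse[of v u R] by (simp add: mult.commute)
qed

text \<open>Describes the fibres of an independent set over a single idempotent. A member need not
  be its own inverse.\<close>

definition inverse_clique :: "'a::comm_ring_1 set \<Rightarrow> bool" where
  "inverse_clique T \<longleftrightarrow> pairwise (\<lambda>u v. u * v = 1) T"

lemma inverse_clique_cases: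
  assumes "inverse_clique T"
  obtains "T = {}" | u where "T = {u}" | u v where "T = {u, v}" "u \<noteq> v" "u * v = 1"
proof -
  have "T = {u, v}" if "u \<in> T" "v \<in> T" "u \<noteq> v" for u v
  proof -
    have "w = v" if "w \<in> T" "w \<noteq> u" for w
      using assms that \<open>u \<in> T\<close> \<open>v \<in> T\<close> \<open>u \<noteq> v\<close> unit_inverse_unique[of u w v]
      unfolding inverse_clique_def pairwise_def by metis
    then show ?thesis using that by blast
  qed
  moreover have "u * v = 1" if "u \<in> T" "v \<in> T" "u \<noteq> v" for u v
    using that assms by (auto simp: inverse_clique_def pairwise_def)
  ultimately show thesis using that by (metis is_singletonI' is_singleton_def)
qed

lemma finite_inverse_clique: "inverse_clique T \<Longrightarrow> finite T"
  by (erule inverse_clique_cases) auto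

lemma card_inverse_clique: "inverse_clique T \<Longrightarrow> card T \<le> 2"
  by (erule inverse_clique_cases) auto

lemma obtain_inverse_pair:
  assumes "inverse_clique T" "\<not> card T \<le> 1"
  obtains u v where "T = {u, v}" "u \<noteq> v" "u * v = 1"
  using assms(1)
proof (cases rule: inverse_clique_cases)
  case (3 u v)
  then show thesis by (rule that)
qed (use assms(2) in auto)

lemma inverse_clique_pair: "u * v = 1 \<Longrightarrow> inverse_clique {u, v}"
  by (auto simp: inverse_clique_def pairwise_def mult.commute)

lemma inverse_clique_sing: "inverse_clique {u}"
  by (auto simp: inverse_clique_def)

section \<open>Counting orthogonal idempotents\<close>

lemma card_orthogonal_le:
  assumes D: "max_orthogonal_idems R D" "finite D" and P: "orthogonal_idems R P" "0 \<notin> P"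
  shows "finite P \<and> card P \<le> card (D - {0})"
proof -
  \<comment> \<open>Adjoining 0 gains one element, which offsets the loss of at most one in passing
    from \<open>D\<close> to \<open>D - {0}\<close>.\<close>
  have "orthogonal_idems R (insert 0 P)"
    using P by (auto simp: orthogonal_idems_def pairwise_def idems_def)
  then have le: "|insert 0 P| \<le>o |D|" using D by (auto simp: max_orthogonal_idems_def)
  then have fin: "finite (insert 0 P)" using D(2) by (rule card_of_ordLeq_finite)
  then have "card (insert 0 P) \<le> card D"
    using le D(2) by (meson card_of_ordLeq inj_on_iff_card_le)
  then have "Suc (card P) \<le> card D" using P(2) fin by simp
  moreover have "card D \<le> Suc (card (D - {0}))"
    using D(2) by (simp add: card_Diff_singleton_if) linarith
  ultimately show ?thesis using fin by simp
qed

text \<open>Everything else orthogonal to 1 is 0, so a \<open>D\<close> containing 1 has a single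
  nonzero member and loses to \<open>{e, 1 - e}\<close>.\<close>

lemma max_orthogonal_subset_nontriv:
  assumes "nontriv_idems R \<noteq> {}" "max_orthogonal_idems R D"
  shows "D - {0} \<subseteq> nontriv_idems R"
proof -
  obtain e where e: "e \<in> idems R" "e \<noteq> 0" "e \<noteq> 1" using assms(1) by (auto simp: nontriv_idems_def)
  have "1 \<notin> D"
  proof
    assume "1 \<in> D"
    have "x = 0" if "x \<in> D" "x \<noteq> 1" for x
      using assms(2) \<open>1 \<in> D\<close> that pairwiseD[of _ D x 1]
      unfolding max_orthogonal_idems_def orthogonal_idems_def by force
    then have sub: "D \<subseteq> {0, 1}" by blast
    then have fin: "finite D" by (rule finite_subset) simp
    have "orthogonal_idems R {e, 1 - e}"
      using e one_minus_mem_idems[OF e(1)] idem_times_compl[OF e(1)]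
      by (auto simp: orthogonal_idems_def pairwise_def)
    moreover have "0 \<notin> {e, 1 - e}" using e by auto
    ultimately have "card {e, 1 - e} \<le> card (D - {0})"
      using card_orthogonal_le[OF assms(2) fin] by blast
    also have "\<dots> \<le> card {1::'a}" using sub by (intro card_mono) auto
    finally show False using compl_neq_idem[OF e(1,2), symmetric] by simp
  qed
  then show ?thesis using assms(2)
    by (auto simp: nontriv_idems_def max_orthogonal_idems_def orthogonal_idems_def)
qed

lemma compl_mem_nontriv: "e \<in> nontriv_idems R \<Longrightarrow> 1 - e \<in> nontriv_idems R"
  using one_minus_mem_idems[of e R] by (auto simp: nontriv_idems_def)

text \<open>\<open>p \<mapsto> 1 - p\<close> maps \<open>P\<close> outside \<open>P \<union> Q\<close>, unless \<open>P\<close> is a singleton or \<open>Q\<close> is empty.\<close>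

lemma double_count:
  assumes fin: "finite (nontriv_idems R)"
    and P: "P \<subseteq> nontriv_idems R" "pairwise (\<lambda>e f. e * f = 0) P"
    and Q: "Q \<subseteq> nontriv_idems R" "\<And>p q. p \<in> P \<Longrightarrow> q \<in> Q \<Longrightarrow> p * q = 0"
    and d: "\<And>X. orthogonal_idems R X \<Longrightarrow> 0 \<notin> X \<Longrightarrow> card X \<le> d"
  shows "2 * card P + card Q \<le> max (2 * d) (card (nontriv_idems R))"
proof -
  let ?N = "nontriv_idems R"
  have N: "x * x = x" "x \<noteq> 0" "x \<noteq> 1" if "x \<in> ?N" for x
    using that by (auto simp: nontriv_idems_def idems_def)
  have finP: "finite P" and finQ: "finite Q" using fin P(1) Q(1) finite_subset by blast+
  have disj: "P \<inter> Q = {}"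
  proof -
    have "x \<notin> Q" if "x \<in> P" for x
      using Q(2)[OF that, of x] N[of x] P(1) that by auto
    then show ?thesis by blast
  qed
  \<comment> \<open>It remains to find \<open>card P\<close> nontrivial idempotents outside
    \<open>P\<close> and \<open>Q\<close>, or to fall back on the bound
    \<open>2 * d\<close>.\<close>
  have extra: "card P + card Q + card X \<le> card ?N" if "X \<subseteq> ?N" "X \<inter> (P \<union> Q) = {}" for X
  proof -
    have "card (P \<union> Q \<union> X) = card P + card Q + card X"
      using that finP finQ fin disj
      by (subst card_Un_disjoint) (auto simp: card_Un_disjoint intro: finite_subset)
    moreover have "card (P \<union> Q \<union> X) \<le> card ?N" using that fin P(1) Q(1) by (intro card_mono) auto
    ultimately show ?thesis by simp
  qed
  consider "P = {}" | "Q = {}" | p q where "p \<in> P" "q \<in> Q" by blast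
  then show ?thesis
  proof cases
    case 1
    then show ?thesis using fin Q(1) by (simp add: card_mono le_max_iff_disj)
  next
    case 2
    have "card P \<le> d"
      using P by (intro d) (auto simp: orthogonal_idems_def nontriv_idems_def)
    then show ?thesis using 2 by simp
  next
    case (3 p q)
    have pN: "p \<in> ?N" and qN: "q \<in> ?N" using 3 P Q by auto
    show ?thesis
    proof (cases "P = {p}")
      case True
      have *: ?thesis if "x \<in> ?N" "x \<notin> P \<union> Q" for x
      proof -
        have "card P + card Q + card {x} \<le> card ?N" using that by (intro extra) auto
        then show ?thesis using True by simp
      qed
      show ?thesis
      proof (cases "Q = {1 - p}")
        case True
        \<comment> \<open>Here the left-hand side is 3, and this orthogonal pair yields
          \<open>d \<ge> 2\<close>.\<close>
        have "orthogonal_idems R {p, 1 - p}"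
          using pN one_minus_mem_idems[of p R] idem_times_compl[of p R]
          by (auto simp: orthogonal_idems_def pairwise_def nontriv_idems_def)
        moreover have "0 \<notin> {p, 1 - p}" using N[OF pN] by auto
        ultimately have "card {p, 1 - p} \<le> d" using d by blast
        moreover have "p \<noteq> 1 - p" using compl_neq_idem[of p R] pN by (auto simp: nontriv_idems_def)
        ultimately show ?thesis using True \<open>P = {p}\<close> by auto
      next
        case False
        show ?thesis
        proof (cases "1 - p \<in> Q")
          case False
          have "1 - p \<noteq> p" using compl_neq_idem[of p R] pN by (auto simp: nontriv_idems_def)
          then show ?thesis using *[OF compl_mem_nontriv[OF pN]] False \<open>P = {p}\<close> by auto
        next
          case True
          \<comment> \<open>Since \<open>p\<close> annihilates \<open>Q\<close> but
            \<open>p * (1 - r) = p\<close> is nonzero, \<open>1 - r\<close> is the required extra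
            idempotent.\<close>
          then obtain r where r: "r \<in> Q" "r \<noteq> 1 - p" using False by blast
          have "p * (1 - r) = p" using Q(2)[OF 3(1) r(1)] by (simp add: algebra_simps)
          then have "1 - r \<notin> Q" using Q(2)[OF 3(1)] N[OF pN] by auto
          moreover have "1 - r \<noteq> p" using r(2) by auto
          ultimately show ?thesis using *[OF compl_mem_nontriv, of r] r Q(1) \<open>P = {p}\<close> by auto
        qed
      qed
    next
      case False
      \<comment> \<open>Another \<open>y\<close> in \<open>P\<close> has
        \<open>y * (1 - x) = y\<close>, which keeps \<open>1 - x\<close> out of \<open>Q\<close>; if
        \<open>1 - x\<close> were in \<open>P\<close>, both \<open>x\<close> and
        \<open>1 - x\<close> would annihilate \<open>q\<close>.\<close>
      have "1 - x \<notin> P \<union> Q" if x: "x \<in> P" for x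
      proof -
        obtain y where y: "y \<in> P" "y \<noteq> x" using False 3(1) x by blast
        have "y * x = 0" using P(2) x y by (auto simp: pairwise_def)
        then have yx: "y * (1 - x) = y" by (simp add: algebra_simps)
        have yN: "y \<noteq> 0" using y P N by blast
        have "1 - x \<notin> Q" using Q(2)[OF y(1)] yx yN by metis
        moreover have "1 - x \<notin> P"
        proof
          assume "1 - x \<in> P"
          then have "(1 - x) * q = 0" "x * q = 0" using Q(2) 3 x by auto
          then show False using N(2)[OF qN] by (simp add: algebra_simps)
        qed
        ultimately show ?thesis by blast
      qed
      then have "card P + card Q + card ((\<lambda>x. 1 - x) ` P) \<le> card ?N"
        using P(1) compl_mem_nontriv by (intro extra) auto
      moreover have "card ((\<lambda>x. 1 - x) ` P) = card P" by (intro card_image inj_onI) simp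
      ultimately show ?thesis by simp
    qed
  qed
qed

section \<open>Upper bounds from the fibres of an independent set\<close>

context
  fixes R :: "'a::comm_ring_1 itself" and S :: "('a \<times> 'a) set"
  assumes nontriv: "nontriv_idems R \<noteq> {}" and units: "\<exists>w. w \<in> units R \<and> w \<noteq> 1"
    and indep: "independent_set (strong_resolving_graph (clean_graph2 R)) S"
begin

lemma independent_subset: "S \<subseteq> (idems R - {0}) \<times> units R"
  using indep independent_set_clean_iff[OF nontriv units] by blast

lemma independentD:
  assumes "(e, u) \<in> S" "(f, v) \<in> S" "(e, u) \<noteq> (f, v)"
  shows "e * f = 0 \<or> u * v = 1 \<or> (e = 1) \<noteq> (f = 1) \<and> u \<noteq> v"
  using indep[unfolded independent_set_clean_iff[OF nontriv units]] assms by blast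

lemma inverse_clique_fibre: "inverse_clique (S `` {e})"
  unfolding inverse_clique_def
proof (rule pairwiseI)
  fix u v assume uv: "u \<in> S `` {e}" "v \<in> S `` {e}" "u \<noteq> v"
  then have "e * e \<noteq> 0" using independent_subset by (auto simp: idems_def)
  with uv show "u * v = 1" using independentD[of e u e v] by auto
qed

lemma finite_fibre: "finite (S `` {e})"
  using inverse_clique_fibre by (rule finite_inverse_clique)

text \<open>The product of the idempotents is \<open>f\<close>, which is nonzero, and the units
  agree, so only \<open>u * u = 1\<close> remains.\<close>

lemma fibre_one_disjoint:
  assumes "(1, u) \<in> S" "(f, u) \<in> S" "f \<noteq> 1"
  shows "u \<notin> units'' R"
  using independentD[OF assms(1,2)] assms independent_subset by (auto simp: units''_iff)

text \<open>Otherwise both units over \<open>p\<close> would be inverse to one and the same unit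
  over \<open>q\<close>.\<close>

lemma large_fibre_orthogonal:
  assumes p: "p \<in> nontriv_idems R" "\<not> card (S `` {p}) \<le> 1"
    and q: "q \<in> nontriv_idems R" "S `` {q} \<noteq> {}" and "p \<noteq> q"
  shows "p * q = 0"
proof (rule ccontr)
  assume pq: "p * q \<noteq> 0"
  obtain u v where uv: "S `` {p} = {u, v}" "u \<noteq> v"
    using inverse_clique_fibre p(2) by (rule obtain_inverse_pair)
  obtain w where w: "(q, w) \<in> S" using q(2) by blast
  have "x * w = 1" if "(p, x) \<in> S" for x
    using independentD[OF that w] pq p(1) q(1) \<open>p \<noteq> q\<close> by (auto simp: nontriv_idems_def)
  moreover have "(p, u) \<in> S" "(p, v) \<in> S" using uv(1) by blast+
  ultimately have "w * u = 1" "w * v = 1" by (simp_all add: mult.commute)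
  with uv(2) show False using unit_inverse_unique by blast
qed

lemma large_fibre_units'':
  assumes "\<not> card (S `` {p}) \<le> 1"
  obtains u v where "S `` {p} = {u, v}" "u \<noteq> v" "u \<in> units'' R" "v \<in> units'' R"
proof -
  obtain u v where uv: "S `` {p} = {u, v}" "u \<noteq> v" "u * v = 1"
    using inverse_clique_fibre assms by (rule obtain_inverse_pair)
  then have "u \<in> units'' R" "v \<in> units'' R"
    using mem_units''_if_inverse[of u v R] mem_units''_if_inverse[of v u R] by (simp_all add: mult.commute)
  with uv that show thesis by blast
qed

text \<open>All fibres are finite, and the infinite index set absorbs them together with the extra
  index 1.\<close>

lemma independent_ordLeq:
  assumes "infinite (nontriv_idems R)"
  shows "|S| \<le>o |nontriv_idems R|"
proof -
  let ?N = "nontriv_idems R"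
  have fin: "|X| \<le>o |?N|" if "finite X" for X :: "'a set"
    using that assms by (metis card_of_Well_order card_of_ordLeq_finite ordLeq_total)
  have "|{1::'a} <+> ?N| =o |?N|"
    using assms fin[of "{1}"] by (intro card_of_Plus_infinite2) auto
  then have "|{1} \<union> ?N| \<le>o |?N|"
    using card_of_Un_Plus_ordLeq ordLeq_ordIso_trans by blast
  moreover have "idems R - {0} \<subseteq> {1} \<union> ?N" by (auto simp: nontriv_idems_def)
  ultimately have "|idems R - {0}| \<le>o |?N|"
    using card_of_mono1 ordLeq_transitive by blast
  then have "|SIGMA e : idems R - {0}. S `` {e}| \<le>o |?N|"
    using assms fin finite_fibre by (intro card_of_Sigma_ordLeq_infinite) auto
  moreover have "S \<subseteq> (SIGMA e : idems R - {0}. S `` {e})" using independent_subset by auto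
  ultimately show ?thesis using card_of_mono1 ordLeq_transitive by blast
qed

context
  assumes fin: "finite (nontriv_idems R)"
begin

lemma independent_fibres: "S = (SIGMA e : insert 1 (nontriv_idems R). S `` {e})"
  using independent_subset by (auto simp: nontriv_idems_def)

lemma finite_independent: "finite S"
  by (subst independent_fibres) (use fin finite_fibre in auto)

lemma card_independent: "card S = card (S `` {1}) + (\<Sum>e\<in>nontriv_idems R. card (S `` {e}))"
proof -
  have "card S = (\<Sum>e\<in>insert 1 (nontriv_idems R). card (S `` {e}))"
    by (subst (1) independent_fibres, rule card_SigmaI) (use fin finite_fibre in auto)
  then show ?thesis using fin by (simp add: nontriv_idems_def)
qed

lemma sum_small_fibres:
  assumes "\<And>e. e \<in> nontriv_idems R \<Longrightarrow> card (S `` {e}) \<le> 1"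
  shows "(\<Sum>e\<in>nontriv_idems R. card (S `` {e})) \<le> card (nontriv_idems R)"
  using sum_bounded_above[of "nontriv_idems R" "\<lambda>e. card (S `` {e})" 1] assms by simp

text \<open>Fibres have at most two elements, so the sum is bounded by
  \<open>2 * card P + card Q\<close>; orthogonality of large fibres makes
  \<open>double_count\<close> applicable.\<close>

lemma sum_fibres_le:
  assumes d: "\<And>X. orthogonal_idems R X \<Longrightarrow> 0 \<notin> X \<Longrightarrow> card X \<le> d"
  shows "(\<Sum>e\<in>nontriv_idems R. card (S `` {e})) \<le> max (2 * d) (card (nontriv_idems R))"
proof -
  let ?N = "nontriv_idems R"
  define P where "P = {e \<in> ?N. \<not> card (S `` {e}) \<le> 1}"
  define Q where "Q = {e \<in> ?N. card (S `` {e}) = 1}"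
  have nonempty: "S `` {e} \<noteq> {}" if "e \<in> P \<union> Q" for e
    using that by (auto simp: P_def Q_def simp del: Image_singleton_iff)
  have orth: "p * q = 0" if "p \<in> P" "q \<in> P \<union> Q" "p \<noteq> q" for p q
    using that nonempty[OF that(2)] large_fibre_orthogonal[of p q] by (auto simp: P_def Q_def)
  have "(\<Sum>e\<in>?N. card (S `` {e})) \<le> (\<Sum>e\<in>?N. (if e \<in> P then 2 else 0) + (if e \<in> Q then 1 else 0))"
  proof (rule sum_mono)
    fix e assume "e \<in> ?N"
    then show "card (S `` {e}) \<le> (if e \<in> P then 2 else 0) + (if e \<in> Q then 1 else 0)"
      using card_inverse_clique[OF inverse_clique_fibre, of e] by (auto simp: P_def Q_def)
  qed
  also have "\<dots> = 2 * card P + card Q"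
  proof -
    have "?N \<inter> {e. e \<in> P} = P" "?N \<inter> {e. e \<in> Q} = Q" by (auto simp: P_def Q_def)
    then show ?thesis using fin by (simp add: sum.distrib sum.If_cases)
  qed
  also have "\<dots> \<le> max (2 * d) (card ?N)"
  proof (rule double_count[OF fin _ _ _ _ d])
    show "P \<subseteq> ?N" "Q \<subseteq> ?N" by (auto simp: P_def Q_def)
    show "pairwise (\<lambda>e f. e * f = 0) P" using orth by (auto simp: pairwise_def)
    show "p * q = 0" if "p \<in> P" "q \<in> Q" for p q
    proof (rule orth)
      show "p \<noteq> q" using that by (auto simp: P_def Q_def)
    qed (use that in auto)
  qed
  finally show ?thesis .
qed

lemma card_independent_le_if_units''_empty:
  assumes "units'' R = {}"
  shows "card S \<le> card (nontriv_idems R) + 1"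
proof -
  have le: "card (S `` {e}) \<le> 1" for e
    using large_fibre_units''[of e] assms by blast
  show ?thesis
    using sum_small_fibres[OF le] le[of 1] unfolding card_independent by simp
qed

lemma card_independent_le:
  assumes "\<And>X. orthogonal_idems R X \<Longrightarrow> 0 \<notin> X \<Longrightarrow> card X \<le> d"
  shows "card S \<le> max (2 * d) (card (nontriv_idems R)) + 2"
  using sum_fibres_le[OF assms] card_inverse_clique[OF inverse_clique_fibre, of 1]
  unfolding card_independent by simp

text \<open>Two units over 1 exhaust \<open>units''\<close>, so all other fibres have at most one
  element and the total is at most \<open>card (nontriv_idems R) + 2\<close>, which strictness of
  \<open>less\<close> brings down to \<open>2 * d + 1\<close>.\<close>

lemma card_independent_le_if_card_units'':
  assumes d: "\<And>X. orthogonal_idems R X \<Longrightarrow> 0 \<notin> X \<Longrightarrow> card X \<le> d"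
    and two: "card (units'' R) = 2" and less: "card (nontriv_idems R) < 2 * d"
  shows "card S \<le> 2 * d + 1"
proof (cases "card (S `` {1}) \<le> 1")
  case True
  then show ?thesis using sum_fibres_le[OF d] less unfolding card_independent by simp
next
  case False
  obtain u v where uv: "S `` {1} = {u, v}" "u \<noteq> v" "u \<in> units'' R" "v \<in> units'' R"
    using False by (rule large_fibre_units'')
  have "finite (units'' R)" using two by (simp add: card_ge_0_finite)
  then have U: "{u, v} = units'' R" using uv two by (intro card_seteq) auto
  have "card (S `` {e}) \<le> 1" if "e \<in> nontriv_idems R" for e
  proof (rule ccontr)
    assume "\<not> card (S `` {e}) \<le> 1"
    then obtain x where x: "(e, x) \<in> S" "x \<in> units'' R" using large_fibre_units''[of e] by blast
    then have "(1, x) \<in> S" using U uv(1) by blast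
    then show False using fibre_one_disjoint[of x e] x that by (auto simp: nontriv_idems_def)
  qed
  then have "(\<Sum>e\<in>nontriv_idems R. card (S `` {e})) \<le> card (nontriv_idems R)"
    by (rule sum_small_fibres)
  then show ?thesis
    using card_inverse_clique[OF inverse_clique_fibre, of 1] less unfolding card_independent by simp
qed

end

end

section \<open>Lower bounds: construction of independent sets\<close>

text \<open>The common shape of the extremal sets in the finite case: \<open>T\<close> over each
  member of \<open>X\<close>, and \<open>T'\<close> over 1. A unit repeated over several idempotents
  needs them orthogonal or the unit self-inverse.\<close>

lemma independent_set_Times:
  assumes "nontriv_idems R \<noteq> {}" "\<exists>w. w \<in> units R \<and> w \<noteq> 1"
    and X: "X \<subseteq> nontriv_idems R" "pairwise (\<lambda>e f. e * f = 0) X \<or> (\<forall>u\<in>T. \<forall>v\<in>T. u * v = 1)"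
    and T: "T \<subseteq> units R" "inverse_clique T" and T': "T' \<subseteq> units R" "inverse_clique T'"
    and disj: "\<And>u. u \<in> T \<Longrightarrow> u \<in> T' \<Longrightarrow> u * u = 1"
  shows "independent_set (strong_resolving_graph (clean_graph2 R)) (X \<times> T \<union> {1} \<times> T')"
  unfolding independent_set_clean_iff[OF assms(1,2)]
proof (intro conjI allI impI; (elim conjE)?)
  obtain g where "g \<in> nontriv_idems R" using assms(1) by blast
  then have one: "(1::'a) \<noteq> 0" by (auto simp: nontriv_idems_def)
  then show "X \<times> T \<union> {1} \<times> T' \<subseteq> (idems R - {0}) \<times> units R"
    using X(1) T(1) T'(1) one_mem_idems[of R] by (auto simp: nontriv_idems_def)
next
  fix e u f v
  assume eu: "(e, u) \<in> X \<times> T \<union> {1} \<times> T'" and fv: "(f, v) \<in> X \<times> T \<union> {1} \<times> T'"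
    and ne: "(e, u) \<noteq> (f, v)"
  have X1: "1 \<notin> X" using X(1) by (auto simp: nontriv_idems_def)
  have cl: "x * y = 1" if "x \<in> T \<and> y \<in> T \<or> x \<in> T' \<and> y \<in> T'" "x \<noteq> y" for x y
    using that T(2) T'(2) unfolding inverse_clique_def pairwise_def by blast
  consider "e \<in> X" "u \<in> T" "f \<in> X" "v \<in> T" | "e \<in> X" "u \<in> T" "f = 1" "v \<in> T'"
    | "e = 1" "u \<in> T'" "f \<in> X" "v \<in> T" | "e = 1" "u \<in> T'" "f = 1" "v \<in> T'"
    using eu fv by blast
  then show "e * f = 0 \<or> u * v = 1 \<or> (e = 1) \<noteq> (f = 1) \<and> u \<noteq> v"
  proof cases
    case 1
    show ?thesis
    proof (cases "u = v")
      case True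
      then show ?thesis using X(2) 1 ne by (auto simp: pairwise_def)
    next
      case False
      then show ?thesis using cl 1 by blast
    qed
  next
    case 2
    then show ?thesis using X1 disj by (cases "u = v") auto
  next
    case 3
    then show ?thesis using X1 disj by (cases "u = v") auto
  next
    case 4
    then show ?thesis using cl ne by blast
  qed
qed

lemma card_Times_Un_one:
  fixes R :: "'a::comm_ring_1 itself"
  assumes "X \<subseteq> nontriv_idems R" "finite X" "finite T" "finite T'"
  shows "card (X \<times> T \<union> {1} \<times> T') = card X * card T + card T'"
proof -
  have "(X \<times> T) \<inter> ({1} \<times> T') = {}" using assms(1) by (auto simp: nontriv_idems_def)
  then show ?thesis using assms by (simp add: card_Un_disjoint card_cartesian_product)
qed

section \<open>Cardinal arithmetic\<close>

lemma card_of_ordLeq_iff_card: "finite A \<Longrightarrow> finite B \<Longrightarrow> |A| \<le>o |B| \<longleftrightarrow> card A \<le> card B"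
  using card_of_ordLeq[of A B] inj_on_iff_card_le[of A B] by blast

lemma card_of_ordIso_iff_card: "finite A \<Longrightarrow> finite B \<Longrightarrow> |A| =o |B| \<longleftrightarrow> card A = card B"
  using card_of_ordIso[of A B] bij_betw_iff_card[of A B] by blast

lemma finite_ordLeq_infinite: "finite A \<Longrightarrow> infinite B \<Longrightarrow> |A| \<le>o |B|"
  using card_of_Well_order[of A] card_of_Well_order[of B] card_of_ordLeq_finite[of B A] ordLeq_total
  by blast

lemma has_independence_number_finiteI:
  assumes "finite X" "independent_set G S" "finite S" "card S = card X"
    and "\<And>S'. independent_set G S' \<Longrightarrow> finite S' \<and> card S' \<le> card X"
  shows "has_independence_number G |X|"
  unfolding has_independence_number_def
  using assms by (meson card_of_ordLeq_iff_card card_of_ordIso_iff_card)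

lemma ctwo_cprod: "ctwo *c |A| = |(UNIV :: bool set) \<times> A|"
  by (simp add: cprod_def ctwo_def Field_card_of)

lemma csum_cone: "|A| +c cone = |A <+> {()}|"
  by (simp add: csum_def cone_def Field_card_of)

lemma csum_ctwo: "|A| +c ctwo = |A <+> (UNIV :: bool set)|"
  by (simp add: csum_def ctwo_def Field_card_of)

text \<open>Realises the maximum by a concrete set, so that it can be evaluated by
  \<open>card\<close> in the finite case and by \<open>=o\<close> in the infinite one.\<close>

lemma cmax_card_of:
  fixes A :: "'a set" and B :: "'b set"
  obtains M :: "('a + 'b) set" where "cmax |A| |B| = |M|"
    "finite A \<Longrightarrow> finite B \<Longrightarrow> finite M \<and> card M = max (card A) (card B)"
    "|A| \<le>o |B| \<Longrightarrow> |M| =o |B|"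
proof (cases "|A| \<le>o |B|")
  case True
  show thesis
  proof (rule that[of "{} <+> B"])
    show "cmax |A| |B| = |{} <+> B|"
      using True by (simp add: cmax_def csum_def czero_def Field_card_of)
    show "finite ({} <+> B :: ('a + 'b) set) \<and> card ({} <+> B :: ('a + 'b) set) = max (card A) (card B)"
      if "finite A" "finite B"
      using that True by (simp add: card_Plus card_of_ordLeq_iff_card max_def)
    show "|{} <+> B :: ('a + 'b) set| =o |B|"
      by (rule ordIso_symmetric[OF card_of_Plus_empty2])
  qed
next
  case False
  show thesis
  proof (rule that[of "A <+> {}"])
    show "cmax |A| |B| = |A <+> {}|"
      using False by (simp add: cmax_def csum_def czero_def Field_card_of)
    show "finite (A <+> {} :: ('a + 'b) set) \<and> card (A <+> {} :: ('a + 'b) set) = max (card A) (card B)"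
      if "finite A" "finite B"
      using that False by (simp add: card_Plus card_of_ordLeq_iff_card max_def)
  qed (use False in blast)
qed

text \<open>The self-inverse unit 1 over all nontrivial idempotents attains the bound of
  \<open>independent_ordLeq\<close>. The set \<open>X\<close> stands for whichever cardinal
  expression is claimed.\<close>

lemma has_independence_number_infinite:
  assumes "nontriv_idems R \<noteq> {}" "\<exists>w. w \<in> units R \<and> w \<noteq> 1" "infinite (nontriv_idems R)"
    and X: "|X| =o |nontriv_idems R|"
  shows "has_independence_number (strong_resolving_graph (clean_graph2 R)) |X|"
proof -
  let ?G = "strong_resolving_graph (clean_graph2 R)" and ?N = "nontriv_idems R"
  have "independent_set ?G (?N \<times> {1} \<union> {1} \<times> {})"
    using one_mem_units[of R] by (intro independent_set_Times[OF assms(1,2)]) (auto simp: inverse_clique_def)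
  then have "independent_set ?G (?N \<times> {1})" by simp
  moreover have "|?N \<times> {1::'a}| =o |?N|"
    using assms(3) finite_ordLeq_infinite[of "{1::'a}" ?N]
    by (intro conjunct1[OF card_of_Times_infinite]) auto
  ultimately show ?thesis
    unfolding has_independence_number_def
    using independent_ordLeq[OF assms(1,2) _ assms(3)] X
    by (meson ordIso_symmetric ordIso_transitive ordLeq_ordIso_trans)
qed

lemma obtain_independent:
  assumes "nontriv_idems R \<noteq> {}" "\<exists>w. w \<in> units R \<and> w \<noteq> 1" "finite (nontriv_idems R)"
    and "X \<subseteq> nontriv_idems R" "pairwise (\<lambda>e f. e * f = 0) X \<or> (\<forall>u\<in>T. \<forall>v\<in>T. u * v = 1)"
    and "T \<subseteq> units R" "inverse_clique T" "T' \<subseteq> units R" "inverse_clique T'"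
    and "\<And>u. u \<in> T \<Longrightarrow> u \<in> T' \<Longrightarrow> u * u = 1"
  obtains S where "independent_set (strong_resolving_graph (clean_graph2 R)) S" "finite S"
    "card S = card X * card T + card T'"
proof -
  have fin: "finite X" "finite T" "finite T'"
    using assms finite_subset finite_inverse_clique by blast+
  show thesis
    by (rule that[OF independent_set_Times[OF assms(1,2,4-10)]])
      (use fin card_Times_Un_one[OF assms(4) fin] in auto)
qed

text \<open>The second and third claims would disagree on a tie, as happens for
  \<open>2 * 3 = 6\<close> with eight idempotents; the negated equality assigns ties to the
  second.\<close>

theorem theorem3p7:
  fixes R :: "'a::comm_ring_1 itself"
  assumes "nontriv_idems R \<noteq> {}"
    and "ctwo \<le>o |units R|"
  shows "(units'' R = {} \<longrightarrow>
            has_independence_number (strong_resolving_graph (clean_graph2 R))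
              ( |nontriv_idems R| +c cone))
    \<and> (\<forall>D. max_orthogonal_idems R D \<and> |units'' R| =o ctwo \<and>
            cmax (ctwo *c |D - {0}| ) |nontriv_idems R| =o |nontriv_idems R| \<longrightarrow>
            has_independence_number (strong_resolving_graph (clean_graph2 R))
              ( |nontriv_idems R| +c ctwo))
    \<and> (\<forall>D. max_orthogonal_idems R D \<and> |units'' R| =o ctwo \<and>
            cmax (ctwo *c |D - {0}| ) |nontriv_idems R| =o ctwo *c |D - {0}| \<and>
            \<not> cmax (ctwo *c |D - {0}| ) |nontriv_idems R| =o |nontriv_idems R| \<longrightarrow>
            has_independence_number (strong_resolving_graph (clean_graph2 R))
              ((ctwo *c |D - {0}| ) +c cone))
    \<and> (\<forall>D. max_orthogonal_idems R D \<and> ctwo <o |units'' R| \<longrightarrow>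
            has_independence_number (strong_resolving_graph (clean_graph2 R))
              (cmax (ctwo *c |D - {0}| ) |nontriv_idems R| +c ctwo))"
proof -
  let ?G = "strong_resolving_graph (clean_graph2 R)" and ?N = "nontriv_idems R"
  let ?B = "UNIV :: bool set"
  note nt = assms(1)
  have un: "\<exists>w. w \<in> units R \<and> w \<noteq> 1"
  proof -
    obtain h :: "bool \<Rightarrow> 'a" where "inj h" "range h \<subseteq> units R"
      using assms(2) unfolding ctwo_def card_of_ordLeq[symmetric] by blast
    then have "h True \<noteq> h False" "h True \<in> units R" "h False \<in> units R" by (auto dest: injD)
    then show ?thesis by metis
  qed
  have T1: "{1} \<subseteq> units R" "inverse_clique {1::'a}" using one_mem_units[of R] inverse_clique_sing by auto
  have pair: "\<exists>u'. {u, u'} \<subseteq> units'' R \<and> {u, u'} \<subseteq> units R \<and> inverse_clique {u, u'} \<and> u \<noteq> u' \<and> u * u' = 1"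
    if "u \<in> units'' R" for u
  proof -
    obtain u' where "u' \<in> units'' R" "u * u' = 1" "u \<noteq> u'"
      using \<open>u \<in> units'' R\<close> by (rule obtain_units''_inverse)
    then show ?thesis using \<open>u \<in> units'' R\<close> inverse_clique_pair by (auto simp: units''_iff)
  qed
  show ?thesis
  proof (cases "finite ?N")
    case inf: False
    note inf_num = has_independence_number_infinite[OF nt un inf]
    have h1: "has_independence_number ?G ( |?N| +c cone)" and h2: "has_independence_number ?G ( |?N| +c ctwo)"
      unfolding csum_cone csum_ctwo
      using inf by (auto intro!: inf_num card_of_Plus_infinite1 finite_ordLeq_infinite)
    \<comment> \<open>The doubled subset \<open>D - {0}\<close> of \<open>?N\<close> is absorbed, so
      the maximum is \<open>|?N|\<close>. This refutes the negated equality, and the third claim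
      holds vacuously.\<close>
    have cm: "cmax (ctwo *c |D - {0}| ) |?N| =o |?N|"
      "has_independence_number ?G (cmax (ctwo *c |D - {0}| ) |?N| +c ctwo)"
      if "max_orthogonal_idems R D" for D
    proof -
      have "|?B \<times> ?N| =o |?N|"
        using inf finite_ordLeq_infinite[of ?B ?N] by (intro conjunct2[OF card_of_Times_infinite]) auto
      moreover have "?B \<times> (D - {0}) \<subseteq> ?B \<times> ?N" using max_orthogonal_subset_nontriv[OF nt that] by blast
      ultimately have le: "|?B \<times> (D - {0})| \<le>o |?N|" using card_of_mono1 ordLeq_ordIso_trans by blast
      obtain M where M: "cmax |?B \<times> (D - {0})| |?N| = |M|" "|M| =o |?N|"
        by (rule cmax_card_of[of "?B \<times> (D - {0})" ?N]) (use le in blast)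
      then show "cmax (ctwo *c |D - {0}| ) |?N| =o |?N|" by (simp add: ctwo_cprod)
      have "infinite M" using M(2) inf card_of_ordIso_finite by blast
      then have "|M <+> ?B| =o |M|" by (auto intro!: card_of_Plus_infinite1 finite_ordLeq_infinite)
      then have "|M <+> ?B| =o |?N|" using M(2) ordIso_transitive by blast
      then show "has_independence_number ?G (cmax (ctwo *c |D - {0}| ) |?N| +c ctwo)"
        unfolding ctwo_cprod M(1) csum_ctwo by (rule inf_num)
    qed
    show ?thesis
      by (intro conjI allI impI; (elim conjE)?) (use cm(1) in \<open>blast intro: h1 h2 cm(2)\<close>)+
  next
    case fin: True
    note obt = obtain_independent[OF nt un fin]
    have finind: "finite S" if "independent_set ?G S" for S
      by (rule finite_independent[OF nt un that fin])
    have NB: "card (?N <+> ?B) = card ?N + 2" "finite (?N <+> ?B)" using fin by (auto simp: card_Plus)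
    have part1: "has_independence_number ?G |?N <+> {()}|" if "units'' R = {}"
    proof -
      obtain S where "independent_set ?G S" "finite S" "card S = card ?N * card {1::'a} + card {1::'a}"
        by (rule obt[of ?N "{1}" "{1}"]) (use T1 in auto)
      then show ?thesis
        using card_independent_le_if_units''_empty[OF nt un _ fin that] finind fin
        by (intro has_independence_number_finiteI[of _ _ S]) (auto simp: card_Plus)
    qed
    have lower2: "\<exists>S. independent_set ?G S \<and> finite S \<and> card S = card ?N + 2" if "u \<in> units'' R" for u
    proof -
      obtain u' where u': "{u, u'} \<subseteq> units'' R" "{u, u'} \<subseteq> units R" "inverse_clique {u, u'}" "u \<noteq> u'"
        using pair[OF \<open>u \<in> units'' R\<close>] by blast
      \<comment> \<open>The unit 1 lies over every nontrivial idempotent, an inverse pair over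
        1.\<close>
      obtain S where "independent_set ?G S" "finite S" "card S = card ?N * card {1::'a} + card {u, u'}"
        by (rule obt[of ?N "{1}" "{u, u'}"]) (use T1 u' in auto)
      then show ?thesis using u'(4) by auto
    qed
    have Dprops: "D - {0} \<subseteq> ?N" "pairwise (\<lambda>e f. e * f = 0) (D - {0})"
        "card (?B \<times> (D - {0})) = 2 * card (D - {0})" "finite (?B \<times> (D - {0}))"
        "\<And>X. orthogonal_idems R X \<Longrightarrow> 0 \<notin> X \<Longrightarrow> card X \<le> card (D - {0})"
      if D: "max_orthogonal_idems R D" for D
    proof -
      show sub: "D - {0} \<subseteq> ?N" by (rule max_orthogonal_subset_nontriv[OF nt D])
      have finD: "finite D" using finite_subset[OF sub fin] by simp
      show "pairwise (\<lambda>e f. e * f = 0) (D - {0})"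
        using D unfolding max_orthogonal_idems_def orthogonal_idems_def by (auto intro: pairwise_subset)
      show "card (?B \<times> (D - {0})) = 2 * card (D - {0})" by (simp add: card_cartesian_product)
      show "finite (?B \<times> (D - {0}))" using finD by simp
      show "card X \<le> card (D - {0})" if "orthogonal_idems R X" "0 \<notin> X" for X
        using card_orthogonal_le[OF D finD that] by blast
    qed
    have part2: "has_independence_number ?G |?N <+> ?B|"
      if D: "max_orthogonal_idems R D" "|units'' R| =o |?B|" "cmax |?B \<times> (D - {0})| |?N| =o |?N|" for D
    proof -
      define d where "d = card (D - {0})"
      note d = Dprops(3,4)[OF D(1), folded d_def] and ort = Dprops(5)[OF D(1), folded d_def]
      obtain M where M: "cmax |?B \<times> (D - {0})| |?N| = |M|" "finite M" "card M = max (2 * d) (card ?N)"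
        by (rule cmax_card_of[of "?B \<times> (D - {0})" ?N]) (use fin d in auto)
      have m: "max (2 * d) (card ?N) = card ?N" using D(3) M fin by (simp add: card_of_ordIso_iff_card)
      obtain u where "u \<in> units'' R"
        using D(2) unfolding card_of_ordIso[symmetric] by (auto simp: bij_betw_def)
      then obtain S where S: "independent_set ?G S" "finite S" "card S = card ?N + 2" using lower2 by blast
      show ?thesis
        using S NB finind card_independent_le[OF nt un _ fin ort] m
        by (intro has_independence_number_finiteI[of _ _ S]) auto
    qed
    have part3: "has_independence_number ?G |?B \<times> (D - {0}) <+> {()}|"
      if D: "max_orthogonal_idems R D" "|units'' R| =o |?B|" "\<not> cmax |?B \<times> (D - {0})| |?N| =o |?N|" for D
    proof -
      define d where "d = card (D - {0})"
      note d = Dprops(3,4)[OF D(1), folded d_def] and ort = Dprops(5)[OF D(1), folded d_def]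
        and dd = d_def Dprops(1,2)[OF D(1)]
      obtain M where M: "cmax |?B \<times> (D - {0})| |?N| = |M|" "finite M" "card M = max (2 * d) (card ?N)"
        by (rule cmax_card_of[of "?B \<times> (D - {0})" ?N]) (use fin d in auto)
      \<comment> \<open>With ties excluded, the inequality is strict.\<close>
      have m: "card ?N < 2 * d" using D(3) M fin by (simp add: card_of_ordIso_iff_card)
      obtain h where "bij_betw h (units'' R) ?B" using D(2) unfolding card_of_ordIso[symmetric] by blast
      then have two: "card (units'' R) = 2" using bij_betw_same_card by fastforce
      then obtain u where u: "u \<in> units'' R" by fastforce
      obtain u' where u': "{u, u'} \<subseteq> units'' R" "{u, u'} \<subseteq> units R" "inverse_clique {u, u'}" "u \<noteq> u'"
        using pair[OF u] by blast
      \<comment> \<open>The inverse pair is repeated over orthogonal idempotents; only the single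
        unit 1 is placed over the idempotent 1.\<close>
      obtain S where "independent_set ?G S" "finite S" "card S = card (D - {0}) * card {u, u'} + card {1::'a}"
        by (rule obt[of "D - {0}" "{u, u'}" "{1}"]) (use T1 u' dd in auto)
      then show ?thesis
        using u'(4) dd(1) d finind card_independent_le_if_card_units''[OF nt un _ fin ort two m]
        by (intro has_independence_number_finiteI[of _ _ S]) (auto simp: card_Plus)
    qed
    have part4: "has_independence_number ?G (cmax |?B \<times> (D - {0})| |?N| +c |?B| )"
      if D: "max_orthogonal_idems R D" "|?B| <o |units'' R|" for D
    proof -
      define d where "d = card (D - {0})"
      note d = Dprops(3,4)[OF D(1), folded d_def] and ort = Dprops(5)[OF D(1), folded d_def]
        and dd = d_def Dprops(1,2)[OF D(1)]
      obtain M where M: "cmax |?B \<times> (D - {0})| |?N| = |M|" "finite M" "card M = max (2 * d) (card ?N)"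
        by (rule cmax_card_of[of "?B \<times> (D - {0})" ?N]) (use fin d in auto)
      \<comment> \<open>Applied to the empty set and to \<open>{u, u'}\<close>, this yields two
        inverse pairs.\<close>
      have notsub: "\<not> units'' R \<subseteq> X" if "finite X" "card X \<le> 2" for X
      proof
        assume "units'' R \<subseteq> X"
        then have "|units'' R| \<le>o |X|" by (rule card_of_mono1)
        also have "|X| \<le>o |?B|" using that by (simp add: card_of_ordLeq_iff_card)
        finally show False using D(2) not_ordLess_ordLeq by blast
      qed
      obtain u where u: "u \<in> units'' R" using notsub[of "{}"] by auto
      obtain u' where u': "{u, u'} \<subseteq> units'' R" "{u, u'} \<subseteq> units R" "inverse_clique {u, u'}" "u \<noteq> u'" "u * u' = 1"
        using pair[OF u] by blast
      obtain v where v: "v \<in> units'' R" "v \<notin> {u, u'}" using notsub[of "{u, u'}"] u'(4) by auto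
      obtain v' where v': "{v, v'} \<subseteq> units'' R" "{v, v'} \<subseteq> units R" "inverse_clique {v, v'}" "v \<noteq> v'" "v * v' = 1"
        using pair[OF v(1)] by blast
      have "u \<noteq> v'" "u' \<noteq> v'"
        using v(2) u'(5) v'(5) unit_inverse_unique[of u u' v] unit_inverse_unique[of u' u v]
        by (auto simp: mult.commute)
      then have disj: "x * x = 1" if "x \<in> {u, u'}" "x \<in> {v, v'}" for x
        using that v(2) by auto
      obtain S where S: "independent_set ?G S" "finite S"
        "card S = card (D - {0}) * card {u, u'} + card {v, v'}"
        by (rule obt[of "D - {0}" "{u, u'}" "{v, v'}"]) (use u' v' dd disj in auto)
      have S2: "card S = 2 * d + 2" using S(3) u'(4) v'(4) dd(1) by simp
      obtain S' where S': "independent_set ?G S'" "finite S'" "card S' = card ?N + 2"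
        using lower2[OF u] by blast
      \<comment> \<open>The two inverse pairs, proved disjoint, give \<open>2 * d + 2\<close>; the
        set from \<open>lower2\<close> gives \<open>card ?N + 2\<close>. The larger one is
        kept.\<close>
      have "\<exists>S. independent_set ?G S \<and> finite S \<and> card S = max (2 * d) (card ?N) + 2"
        using S S2 S' by (cases "2 * d \<le> card ?N") (auto simp: max_def)
      then obtain S0 where S0: "independent_set ?G S0" "finite S0" "card S0 = max (2 * d) (card ?N) + 2"
        by blast
      have cM: "finite (M <+> ?B)" "card (M <+> ?B) = max (2 * d) (card ?N) + 2"
        using M by (simp_all add: card_Plus)
      show ?thesis
        unfolding M(1) csum_ctwo[unfolded ctwo_def] using S0 cM finind card_independent_le[OF nt un _ fin ort]
        by (intro has_independence_number_finiteI[of _ _ S0]) auto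
    qed
    show ?thesis
      unfolding ctwo_cprod csum_cone csum_ctwo unfolding ctwo_def
      by (intro conjI allI impI; (elim conjE)?) (rule part1 part2 part3 part4; assumption)+
  qed
qed

end
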